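(* Let $\mathcal{G}$ be a geometric algebra and let $r\ge 1$. The outer product $a_1\wedge a_2\wedge\dotsb\wedge a_r$ of any $r$ vectors $a_1,\dotsc,a_r\in\mathcal{G}_1$ is an $r$-blade, and every $r$-blade in $\mathcal{G}$ is the outer product of some $r$ vectors.
   Context: A geometric algebra $\mathcal{G}$ is a ring with unit containing a field $\mathcal{G}_0$ of characteristic zero (the scalars, with $0,1\in\mathcal{G}_0$) and a subset $\mathcal{G}_1$ (the vectors) closed under addition with $\lambda v=v\lambda\in\mathcal{G}_1$ for all $\lambda\in\mathcal{G}_0$, $v\in\mathcal{G}_1$ (so $\mathcal{G}_1$ is a $\mathcal{G}_0$-vector space), such that: the square of every vector is a scalar; the symmetric bilinear inner product of vectors $u\rfloor v:=\frac12(uv+vu)\in\mathcal{G}_0$ is nondegenerate (the only vector orthogonal to all vectors is $0$); and, with the sets $\mathcal{G}_r$ defined as follows, if $\mathcal{G}_0=\mathcal{G}_1$ then $\mathcal{G}=\mathcal{G}_0$, and otherwise $\mathcal{G}$ is the direct sum of all the $\mathcal{G}_r$, $r\ge 0$. Vectors $u,v$ are orthogonal if $u\rfloor v=0$ (equivalently, they anticommute). For $r\ge 2$ an $r$-blade is a product of $r$ pairwise orthogonal vectors; $0$-blades are the scalars and $1$-blades the vectors. An $r$-vector is a finite sum of $r$-blades, and $\mathcal{G}_r$ is the set of $r$-vectors. The outer product of vectors $a_1,\dotsc,a_r$ is their fully antisymmetrized product $$a_1\wedge\dotsb\wedge a_r:=\frac{1}{r!}\sum_\sigma(\operatorname{sgn}\sigma)\,a_{\sigma(1)}a_{\sigma(2)}\dotsb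 a_{\sigma(r)},$$ the sum being over all permutations $\sigma$ of $\{1,\dotsc,r\}$. *)

theory Defs
  imports Main "HOL-Combinatorics.Permutations"
begin

text \<open>
  The algebra is a type of class \<open>ring_1\<close>; the scalars \<open>G0\<close> and the vectors \<open>G1\<close> are subsets
  of it. Finite families of vectors \<open>a 1, \<dots>, a r\<close> are functions on \<open>nat\<close> of which only the
  values on \<open>{1..r}\<close> matter.
\<close>

text \<open>
  The two-sided inverse, unspecified on non-units. It is only applied to positive integers, which
  are units in a ring that contains a field of characteristic zero.
\<close>

definition ring_inverse :: "'a::ring_1 \<Rightarrow> 'a" where
  "ring_inverse x = (THE y. x * y = 1 \<and> y * x = 1)"

lemma ring_inverse_eqI:
  assumes "x * y = 1" and "y * x = 1"
  shows "ring_inverse x = y"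
  unfolding ring_inverse_def
proof (rule the_equality)
  show "x * y = 1 \<and> y * x = 1"
    using assms by simp
next
  fix z assume z: "x * z = 1 \<and> z * x = 1"
  have "z = (y * x) * z"
    using assms by simp
  also have "\<dots> = y"
    using z by (simp add: mult.assoc)
  finally show "z = y" .
qed

definition inner_prod :: "'a::ring_1 \<Rightarrow> 'a \<Rightarrow> 'a" where
  "inner_prod u v = ring_inverse 2 * (u * v + v * u)"

definition ordered_prod :: "nat \<Rightarrow> (nat \<Rightarrow> 'a::ring_1) \<Rightarrow> 'a" where
  "ordered_prod r a = prod_list (map a [1..<Suc r])"

definition outer_prod :: "nat \<Rightarrow> (nat \<Rightarrow> 'a::ring_1) \<Rightarrow> 'a" where
  "outer_prod r a =
     ring_inverse (of_nat (fact r)) *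
       (\<Sum>\<sigma> | \<sigma> permutes {1..r}. of_int (sign \<sigma>) * ordered_prod r (\<lambda>i. a (\<sigma> i)))"

text \<open>
  Orthogonality is required for distinct indices, so a vector that occurs twice has to be
  orthogonal to itself.
\<close>

definition blades :: "'a::ring_1 set \<Rightarrow> 'a set \<Rightarrow> nat \<Rightarrow> 'a set" where
  "blades G0 G1 r =
     (if r = 0 then G0
      else if r = 1 then G1
      else {ordered_prod r v | v.
              (\<forall>i\<in>{1..r}. v i \<in> G1) \<and>
              (\<forall>i\<in>{1..r}. \<forall>j\<in>{1..r}. i \<noteq> j \<longrightarrow> inner_prod (v i) (v j) = 0)})"

definition multivectors :: "'a::ring_1 set \<Rightarrow> 'a set \<Rightarrow> nat \<Rightarrow> 'a set" where
  "multivectors G0 G1 r = {sum_list bs | bs. set bs \<subseteq> blades G0 G1 r}"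

definition direct_sum_decomposition :: "(nat \<Rightarrow> 'a::ring_1 set) \<Rightarrow> bool" where
  "direct_sum_decomposition A \<longleftrightarrow>
     (\<forall>x. \<exists>!f. (\<forall>r. f r \<in> A r) \<and> finite {r. f r \<noteq> 0} \<and> x = (\<Sum>r | f r \<noteq> 0. f r))"

locale geometric_algebra =
  fixes G0 G1 :: "'a::ring_1 set"
  assumes scalar_zero: "0 \<in> G0"
    and scalar_one: "1 \<in> G0"
    and scalar_add: "\<lbrakk>x \<in> G0; y \<in> G0\<rbrakk> \<Longrightarrow> x + y \<in> G0"
    and scalar_uminus: "x \<in> G0 \<Longrightarrow> - x \<in> G0"
    and scalar_mult: "\<lbrakk>x \<in> G0; y \<in> G0\<rbrakk> \<Longrightarrow> x * y \<in> G0"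
    and scalar_commute: "\<lbrakk>x \<in> G0; y \<in> G0\<rbrakk> \<Longrightarrow> x * y = y * x"
    and scalar_inverse: "\<lbrakk>x \<in> G0; x \<noteq> 0\<rbrakk> \<Longrightarrow> \<exists>y\<in>G0. x * y = 1"
    and char_zero: "n > 0 \<Longrightarrow> (of_nat n :: 'a) \<noteq> 0"
    and vector_zero: "0 \<in> G1"
    and vector_add: "\<lbrakk>u \<in> G1; v \<in> G1\<rbrakk> \<Longrightarrow> u + v \<in> G1"
    and vector_scale: "\<lbrakk>c \<in> G0; v \<in> G1\<rbrakk> \<Longrightarrow> c * v \<in> G1"
    and vector_scale_commute: "\<lbrakk>c \<in> G0; v \<in> G1\<rbrakk> \<Longrightarrow> c * v = v * c"
    and vector_square: "v \<in> G1 \<Longrightarrow> v * v \<in> G0"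
    and nondegenerate: "\<lbrakk>u \<in> G1; \<And>v. v \<in> G1 \<Longrightarrow> inner_prod u v = 0\<rbrakk> \<Longrightarrow> u = 0"
    and scalars_only: "G0 = G1 \<Longrightarrow> G0 = UNIV"
    and graded: "G0 \<noteq> G1 \<Longrightarrow> direct_sum_decomposition (multivectors G0 G1)"

text \<open>The inner product of vectors is scalar-valued, by polarization of \<open>vector_square\<close>.\<close>

lemma (in geometric_algebra) inner_prod_scalar:
  assumes u: "u \<in> G1" and v: "v \<in> G1"
  shows "inner_prod u v \<in> G0"
proof -
  have two: "2 \<in> G0"
    using scalar_add[OF scalar_one scalar_one] by simp
  moreover have "(2::'a) \<noteq> 0"
    using char_zero[of 2] by simp
  ultimately obtain h where h: "h \<in> G0" "2 * h = 1"
    using scalar_inverse by blast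
  have "ring_inverse 2 = h"
    using h scalar_commute[OF two h(1)] by (intro ring_inverse_eqI) simp_all
  moreover have "u * v + v * u = (u + v) * (u + v) + - (u * u) + - (v * v)"
    by (simp add: algebra_simps)
  ultimately show ?thesis
    unfolding inner_prod_def
    by (metis h(1) scalar_mult scalar_add scalar_uminus vector_square vector_add u v)
qed

end

theory Submission imports Defs begin

text \<open>
  Adding a scalar multiple of one vector to another one does not change an outer product, because
  the outer product is multilinear and alternating. Such transvections suffice to diagonalize the
  Gram matrix of \<open>a 1, \<dots>, a r\<close> in characteristic other than 2, whether or not the vectors are
  linearly independent: a vector that is not null is split off by subtracting projections, and if
  all vectors are null but two of them are not orthogonal, then their sum is not null. For pairwise
  orthogonal vectors the terms of the antisymmetrized product all coincide, so that it is the
  ordered product.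
\<close>

subsection \<open>Ordered products\<close>

lemma ordered_prod_0 [simp]: "ordered_prod 0 a = 1"
  by (simp add: ordered_prod_def)

lemma ordered_prod_Suc [simp]: "ordered_prod (Suc r) a = ordered_prod r a * a (Suc r)"
  by (simp add: ordered_prod_def)

lemma ordered_prod_cong:
  "(\<And>i. i \<in> {1..r} \<Longrightarrow> a i = b i) \<Longrightarrow> ordered_prod r a = ordered_prod r b"
  by (induction r) auto

lemma ordered_prod_commute:
  "(\<And>i. i \<in> {1..r} \<Longrightarrow> c * a i = a i * c) \<Longrightarrow> c * ordered_prod r a = ordered_prod r a * c"
proof (induction r)
  case (Suc r)
  then have "c * ordered_prod r a = ordered_prod r a * c" "c * a (Suc r) = a (Suc r) * c"
    by auto
  then show ?case
    by (simp flip: mult.assoc) (simp add: mult.assoc)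
qed simp

text \<open>The coefficient \<open>c\<close> moves to the front because it commutes with the factors
  that precede position \<open>k\<close>.\<close>

lemma ordered_prod_linear:
  assumes "k \<in> {1..r}" and "\<And>i. i \<in> {1..r} \<Longrightarrow> c * a i = a i * c"
  shows "ordered_prod r (a(k := x + c * y)) =
           ordered_prod r (a(k := x)) + c * ordered_prod r (a(k := y))"
  using assms
proof (induction r)
  case (Suc r)
  show ?case
  proof (cases "k = Suc r")
    case True
    have "ordered_prod r (a(k := z)) = ordered_prod r a" for z
      using True by (intro ordered_prod_cong) auto
    moreover have "c * ordered_prod r a = ordered_prod r a * c"
      using Suc.prems(2) by (intro ordered_prod_commute) auto
    ultimately show ?thesis
      using True by (simp add: distrib_left del: fun_upd_apply add: fun_upd_same flip: mult.assoc)
  next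
    case False
    then show ?thesis
      using Suc by (simp add: distrib_right mult.assoc)
  qed
qed simp

section \<open>Signs from permuting anticommuting factors\<close>

text \<open>Orthogonality phrased without the factor one half, so that the sign computations work in
  every ring with unit.\<close>

definition anticommuting :: "nat \<Rightarrow> (nat \<Rightarrow> 'a::ring_1) \<Rightarrow> bool" where
  "anticommuting r v \<longleftrightarrow>
     (\<forall>i\<in>{1..r}. \<forall>j\<in>{1..r}. i \<noteq> j \<longrightarrow> v i * v j = - (v j * v i))"

lemma anticommutingD:
  "\<lbrakk>anticommuting r v; i \<in> {1..r}; j \<in> {1..r}; i \<noteq> j\<rbrakk> \<Longrightarrow> v i * v j = - (v j * v i)"
  unfolding anticommuting_def by blast

lemma anticommuting_permute:
  assumes "anticommuting r v" and "\<sigma> permutes {1..r}"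
  shows "anticommuting r (\<lambda>i. v (\<sigma> i))"
  unfolding anticommuting_def
proof (intro ballI impI)
  fix i j assume "i \<in> {1..r}" "j \<in> {1..r}" "i \<noteq> j"
  then have "\<sigma> i \<in> {1..r}" "\<sigma> j \<in> {1..r}" "\<sigma> i \<noteq> \<sigma> j"
    using permutes_in_image[OF assms(2)] permutes_inj[OF assms(2)] by (auto dest: injD)
  then show "v (\<sigma> i) * v (\<sigma> j) = - (v (\<sigma> j) * v (\<sigma> i))"
    by (rule anticommutingD[OF assms(1)])
qed

text \<open>Induction strips the last factor: either the swap concerns the last two factors, which
  anticommute, or it leaves the last one fixed.\<close>

lemma ordered_prod_adjacent_transpose:
  assumes "anticommuting r v" and "1 \<le> k" and "Suc k \<le> r"
  shows "ordered_prod r (\<lambda>i. v (transpose k (Suc k) i)) = - ordered_prod r v"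
  using assms
proof (induction r)
  case (Suc r)
  show ?case
  proof (cases "k = r")
    case True
    then obtain m where m: "k = Suc m" "r = Suc m"
      using Suc.prems by (cases k) auto
    have "ordered_prod m (\<lambda>i. v (transpose k (Suc k) i)) = ordered_prod m v"
      using m by (intro ordered_prod_cong) (auto simp: transpose_def)
    moreover have "v (Suc k) * v k = - (v k * v (Suc k))"
      using Suc.prems(2) True by (intro anticommutingD[OF Suc.prems(1)]) auto
    ultimately show ?thesis
      using m by (simp add: mult.assoc)
  next
    case False
    have "anticommuting r v"
      unfolding anticommuting_def by (intro ballI impI anticommutingD[OF Suc.prems(1)]) auto
    then have "ordered_prod r (\<lambda>i. v (transpose k (Suc k) i)) = - ordered_prod r v"
      using False Suc.prems by (intro Suc.IH) auto
    then show ?thesis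
      using False Suc.prems by (simp add: transpose_def)
  qed
qed simp

text \<open>The transposition of \<open>k\<close> and \<open>l + 1\<close> is the conjugate of that
  of \<open>k\<close> and \<open>l\<close> by the adjacent swap of \<open>l\<close> and
  \<open>l + 1\<close>. The three swaps contribute three signs, hence one.\<close>

lemma ordered_prod_transpose_Suc_add:
  assumes "anticommuting r v" and "1 \<le> k" and "Suc (k + n) \<le> r"
  shows "ordered_prod r (\<lambda>i. v (transpose k (Suc (k + n)) i)) = - ordered_prod r v"
  using assms
proof (induction n arbitrary: v)
  case 0
  then show ?case
    by (simp add: ordered_prod_adjacent_transpose)
next
  case (Suc n)
  let ?l = "Suc (k + n)"
  let ?s = "transpose ?l (Suc ?l)"
  have s: "?s permutes {1..r}" and t: "transpose k ?l permutes {1..r}"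
    using Suc.prems by (auto intro!: permutes_swap_id)
  note w = anticommuting_permute[OF Suc.prems(1) s]
  have "transpose k (Suc ?l) i = ?s (transpose k ?l (?s i))" for i
    by (auto simp: transpose_def)
  then have "ordered_prod r (\<lambda>i. v (transpose k (Suc ?l) i))
      = ordered_prod r (\<lambda>i. v (?s (transpose k ?l (?s i))))"
    by simp
  also have "\<dots> = - ordered_prod r (\<lambda>i. v (?s (transpose k ?l i)))"
    using Suc.prems
    by (intro ordered_prod_adjacent_transpose[OF anticommuting_permute[OF w t]]) auto
  also have "\<dots> = ordered_prod r (\<lambda>i. v (?s i))"
    using Suc.IH[OF w] Suc.prems by simp
  also have "\<dots> = - ordered_prod r v"
    using Suc.prems by (intro ordered_prod_adjacent_transpose) auto
  finally show ?case by simp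
qed

lemma ordered_prod_transpose:
  assumes "anticommuting r v" and "k \<in> {1..r}" and "l \<in> {1..r}" and "k \<noteq> l"
  shows "ordered_prod r (\<lambda>i. v (transpose k l i)) = - ordered_prod r v"
proof -
  have *: "ordered_prod r (\<lambda>i. v (transpose k l i)) = - ordered_prod r v"
    if "k \<in> {1..r}" "l \<in> {1..r}" "k < l" for k l
    using that ordered_prod_transpose_Suc_add[OF assms(1), of k "l - Suc k"] by simp
  show ?thesis
    using *[of k l] *[of l k] assms(2-4) by (cases "k < l") (auto simp: transpose_commute)
qed

text \<open>A permutation is built from transpositions, each of which flips both the sign and the
  product. The family \<open>v\<close> varies because the induction hypothesis is applied to
  \<open>v\<close> composed with a transposition.\<close>

lemma ordered_prod_permute:
  assumes "anticommuting r v" and "\<sigma> permutes {1..r}"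
  shows "ordered_prod r (\<lambda>i. v (\<sigma> i)) = of_int (sign \<sigma>) * ordered_prod r v"
  using assms(2) finite_atLeastAtMost assms(1)
proof (induction \<sigma> arbitrary: v rule: permutes_induct)
  case (swap a b p)
  show ?case
  proof (cases "a = b")
    case False
    have t: "transpose a b permutes {1..r}"
      using swap by (intro permutes_swap_id)
    have "permutation p"
      using swap permutation_permutes by blast
    then have "sign (transpose a b \<circ> p) = - sign p"
      using False by (simp add: sign_compose permutation_swap_id sign_swap_id)
    moreover have "ordered_prod r (\<lambda>i. v (transpose a b (p i)))
        = of_int (sign p) * ordered_prod r (\<lambda>i. v (transpose a b i))"
      using swap.IH[OF anticommuting_permute[OF swap.prems t]] .
    ultimately show ?thesis
      using ordered_prod_transpose[OF swap.prems] swap.hyps False by (simp add: comp_def)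
  qed (use swap in simp)
qed simp_all

subsection \<open>Transvections and orthogonalization\<close>

context geometric_algebra
begin

section \<open>Scalars and the inner product\<close>

lemma of_nat_scalar: "of_nat n \<in> G0"
  by (induction n) (auto intro: scalar_zero scalar_one scalar_add)

lemma ring_inverse_of_nat_scalar:
  assumes "n > 0"
  shows "ring_inverse (of_nat n) \<in> G0" and "ring_inverse (of_nat n) * of_nat n = (1::'a)"
proof -
  obtain y where "y \<in> G0" "of_nat n * y = 1"
    using scalar_inverse[OF of_nat_scalar char_zero[OF assms]] by blast
  moreover from this have "y * of_nat n = 1"
    using scalar_commute of_nat_scalar by metis
  ultimately show "ring_inverse (of_nat n) \<in> G0" "ring_inverse (of_nat n) * of_nat n = (1::'a)"
    using ring_inverse_eqI by metis+
qed

lemma ring_inverse_of_nat: "n > 0 \<Longrightarrow> ring_inverse (of_nat n) * (of_nat n * x) = (x::'a)"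
  by (simp add: ring_inverse_of_nat_scalar flip: mult.assoc)

lemma half_scalar: "ring_inverse 2 \<in> G0"
  using ring_inverse_of_nat_scalar(1)[of 2] by simp

lemma double_eq_0: "x + x = 0 \<longleftrightarrow> x = (0::'a)"
  using ring_inverse_of_nat[of 2 x] by (auto simp flip: mult_2)

text \<open>Multiplying by 2 cancels the factor \<open>ring_inverse 2\<close>; this turns
  orthogonality into anticommutation.\<close>

lemma inner_prod_eq_0: "inner_prod u v = (0::'a) \<longleftrightarrow> u * v = - (v * u)"
proof -
  have "2 * (ring_inverse 2 * x) = x" for x :: 'a
    using ring_inverse_of_nat[of 2 x] scalar_commute[OF half_scalar of_nat_scalar[of 2]]
    by (simp flip: mult.assoc)
  then have "inner_prod u v = 0 \<longleftrightarrow> u * v + v * u = 0"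
    unfolding inner_prod_def by (metis mult_zero_right)
  then show ?thesis
    by (simp add: eq_neg_iff_add_eq_0)
qed

lemma inner_prod_commute: "inner_prod u v = inner_prod v u"
  by (simp add: inner_prod_def add.commute)

lemma inner_prod_linear:
  assumes "c \<in> G0" and "w \<in> G1"
  shows "inner_prod (u + c * v) w = inner_prod u w + c * inner_prod v w"
proof -
  have "ring_inverse 2 * (c * x) = c * (ring_inverse 2 * x)" for x
    using scalar_commute[OF half_scalar assms(1)] by (simp flip: mult.assoc)
  moreover have "w * (c * v) = c * (w * v)"
    using vector_scale_commute[OF assms] by (simp flip: mult.assoc)
  ultimately show ?thesis
    by (simp add: inner_prod_def distrib_left distrib_right mult.assoc add_ac)
qed

lemma inner_prod_linear_eq_0:
  assumes "c \<in> G0" and "w \<in> G1" and "inner_prod u w = 0" and "inner_prod v w = 0"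
  shows "inner_prod (u + c * v) w = 0"
  using assms by (simp add: inner_prod_linear)

lemma vector_lincomb: "\<lbrakk>u \<in> G1; c \<in> G0; v \<in> G1\<rbrakk> \<Longrightarrow> u + c * v \<in> G1"
  by (intro vector_add vector_scale)

section \<open>The outer product is alternating and multilinear\<close>

text \<open>Composing every permutation with the transposition of \<open>i\<close> and
  \<open>j\<close> keeps the product and flips the sign. The sum thus equals its own negative and
  vanishes in characteristic other than 2.\<close>

lemma outer_prod_repeated:
  fixes a :: "nat \<Rightarrow> 'a"
  assumes "i \<in> {1..r}" and "j \<in> {1..r}" and "i \<noteq> j" and "a i = a j"
  shows "outer_prod r a = 0"
proof -
  let ?t = "transpose i j"
  let ?f = "\<lambda>\<sigma>. of_int (sign \<sigma>) * ordered_prod r (\<lambda>k. a (\<sigma> k))"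
  have t: "?t permutes {1..r}"
    using assms by (intro permutes_swap_id)
  have "sum ?f {\<sigma>. \<sigma> permutes {1..r}} = (\<Sum>\<sigma> | \<sigma> permutes {1..r}. ?f (?t \<circ> \<sigma>))"
    by (rule setum_permutations_compose_left[OF t])
  also have "\<dots> = (\<Sum>\<sigma> | \<sigma> permutes {1..r}. - ?f \<sigma>)"
  proof (rule sum.cong)
    fix \<sigma> assume "\<sigma> \<in> {\<sigma>. \<sigma> permutes {1..r}}"
    then have "permutation \<sigma>"
      by (auto intro: permutes_imp_permutation)
    then have "sign (?t \<circ> \<sigma>) = - sign \<sigma>"
      using assms(3) by (simp add: sign_compose permutation_swap_id sign_swap_id)
    moreover have "a (?t k) = a k" for k
      using assms(4) by (auto simp: transpose_def)
    ultimately show "?f (?t \<circ> \<sigma>) = - ?f \<sigma>"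
      by simp
  qed simp
  finally have "sum ?f {\<sigma>. \<sigma> permutes {1..r}} = 0"
    using double_eq_0 by (simp add: sum_negf eq_neg_iff_add_eq_0)
  then show ?thesis
    by (simp add: outer_prod_def)
qed

text \<open>Each term of the antisymmetrization is linear in the vector in slot \<open>k\<close>,
  and \<open>c\<close> commutes with the scalar in front of the sum.\<close>

lemma outer_prod_linear:
  assumes "k \<in> {1..r}" and "c \<in> G0" and "\<forall>i\<in>{1..r}. a i \<in> G1"
  shows "outer_prod r (a(k := x + c * y)) = outer_prod r (a(k := x)) + c * outer_prod r (a(k := y))"
proof -
  let ?h = "ring_inverse (of_nat (fact r)) :: 'a"
  define F where "F z \<sigma> = of_int (sign \<sigma>) * ordered_prod r (\<lambda>i. (a(k := z)) (\<sigma> i))" for z \<sigma>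
  have F: "F (x + c * y) \<sigma> = F x \<sigma> + c * F y \<sigma>" if \<sigma>: "\<sigma> permutes {1..r}" for \<sigma>
  proof -
    \<comment> \<open>In the product belonging to \<open>\<sigma>\<close>, slot \<open>k\<close>
      occurs at position \<open>inv \<sigma> k\<close> only.\<close>
    have "(\<lambda>i. (a(k := z)) (\<sigma> i)) = (\<lambda>i. a (\<sigma> i))(inv \<sigma> k := z)" for z
      using permutes_inverses[OF \<sigma>] by (auto simp: fun_eq_iff)
    moreover have "inv \<sigma> k \<in> {1..r}"
      using permutes_in_image[OF permutes_inv[OF \<sigma>]] assms(1) by simp
    moreover have "c * a (\<sigma> i) = a (\<sigma> i) * c" if "i \<in> {1..r}" for i
      using permutes_in_image[OF \<sigma>, of i] that assms vector_scale_commute by blast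
    ultimately have "ordered_prod r (\<lambda>i. (a(k := x + c * y)) (\<sigma> i)) =
        ordered_prod r (\<lambda>i. (a(k := x)) (\<sigma> i)) + c * ordered_prod r (\<lambda>i. (a(k := y)) (\<sigma> i))"
      using ordered_prod_linear[of "inv \<sigma> k" r c "\<lambda>i. a (\<sigma> i)"] by simp
    \<comment> \<open>The sign is an integer and hence central, so \<open>c\<close> can be moved
      past it.\<close>
    then show ?thesis
      by (simp add: F_def distrib_left) (metis mult.assoc mult_of_int_commute)
  qed
  have "?h * c = c * ?h"
    using scalar_commute[OF ring_inverse_of_nat_scalar(1) assms(2), of "fact r"] by simp
  then have h: "?h * (c * z) = c * (?h * z)" for z
    by (metis mult.assoc)
  have *: "outer_prod r (a(k := z)) = ?h * sum (F z) {\<sigma>. \<sigma> permutes {1..r}}" for z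
    unfolding outer_prod_def F_def ..
  have "sum (F (x + c * y)) {\<sigma>. \<sigma> permutes {1..r}}
      = sum (F x) {\<sigma>. \<sigma> permutes {1..r}} + c * sum (F y) {\<sigma>. \<sigma> permutes {1..r}}"
    using F by (simp add: sum.distrib sum_distrib_left)
  then show ?thesis
    unfolding * by (simp only: distrib_left h)
qed

text \<open>By linearity the change is \<open>c\<close> times an outer product with
  \<open>a j\<close> in both slots \<open>i\<close> and \<open>j\<close>, which is zero.\<close>

lemma outer_prod_transvection:
  assumes "i \<in> {1..r}" and "j \<in> {1..r}" and "i \<noteq> j" and "c \<in> G0" and "\<forall>i\<in>{1..r}. a i \<in> G1"
  shows "outer_prod r (a(i := a i + c * a j)) = outer_prod r a"
  using outer_prod_linear[OF assms(1,4,5), of "a i" "a j"]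
    outer_prod_repeated[of i r j "a(i := a j)"] assms(1-3) by simp

lemma outer_prod_transvections:
  assumes "finite T" and "T \<subseteq> {1..r} - {i}" and "i \<in> {1..r}"
    and "\<And>k. k \<in> T \<Longrightarrow> c k \<in> G0" and a: "\<forall>k\<in>{1..r}. a k \<in> G1"
  shows "outer_prod r (\<lambda>k. if k \<in> T then a k + c k * a i else a k) = outer_prod r a"
  using assms(1,2,4)
proof (induction T rule: finite_induct)
  case (insert m T)
  let ?b = "\<lambda>k. if k \<in> T then a k + c k * a i else a k"
  \<comment> \<open>Since neither \<open>i\<close> nor \<open>m\<close> lies in \<open>T\<close>,
    \<open>?b\<close> still has the original vectors \<open>a i\<close> and \<open>a m\<close> in
    these slots.\<close>
  have "outer_prod r (?b(m := ?b m + c m * ?b i)) = outer_prod r ?b"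
    using insert.prems assms(3) a by (intro outer_prod_transvection) (auto intro: vector_lincomb)
  moreover have "?b(m := ?b m + c m * ?b i) = (\<lambda>k. if k \<in> insert m T then a k + c k * a i else a k)"
    using insert.hyps insert.prems by (auto simp: fun_eq_iff)
  ultimately show ?case
    using insert by simp
qed simp

text \<open>The sign from reordering cancels the sign in the sum, leaving \<open>fact r\<close>
  equal terms.\<close>

lemma outer_prod_orthogonal:
  fixes v :: "nat \<Rightarrow> 'a"
  assumes "anticommuting r v"
  shows "outer_prod r v = ordered_prod r v"
proof -
  have "of_int (sign \<sigma>) * ordered_prod r (\<lambda>i. v (\<sigma> i)) = ordered_prod r v"
    if "\<sigma> permutes {1..r}" for \<sigma>
    using ordered_prod_permute[OF assms that]
    by (simp flip: mult.assoc of_int_mult)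
  then have "outer_prod r v
      = ring_inverse (of_nat (fact r)) * (of_nat (card {\<sigma>. \<sigma> permutes {1..r}}) * ordered_prod r v)"
    by (simp add: outer_prod_def)
  then show ?thesis
    using ring_inverse_of_nat[of "fact r"] by (simp add: card_permutations)
qed

section \<open>Diagonalizing the Gram matrix by transvections\<close>

text \<open>Records progress: \<open>S\<close> holds the indices still to be treated. For
  \<open>S = {1..r}\<close> nothing is required, and for \<open>S = {}\<close> the family is
  pairwise orthogonal.\<close>

definition orthogonal_outside :: "nat \<Rightarrow> nat set \<Rightarrow> (nat \<Rightarrow> 'a) \<Rightarrow> bool" where
  "orthogonal_outside r S a \<longleftrightarrow>
     (\<forall>i\<in>{1..r} - S. \<forall>j\<in>{1..r}. i \<noteq> j \<longrightarrow> inner_prod (a i) (a j) = 0)"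

lemma orthogonal_outsideD:
  assumes "orthogonal_outside r S a" and "k \<in> {1..r}" and "l \<in> {1..r} - S" and "k \<noteq> l"
  shows "inner_prod (a k) (a l) = 0"
  using assms inner_prod_commute[of "a k"] by (simp add: orthogonal_outside_def)

text \<open>A Gram-Schmidt step: the projections onto \<open>a i\<close> are subtracted from the
  other vectors with index in \<open>S\<close>. Orthogonality to the vectors outside
  \<open>S\<close> survives, as \<open>a i\<close> is orthogonal to them as well.\<close>

lemma split_off_nonnull:
  assumes a: "\<forall>k\<in>{1..r}. a k \<in> G1" and S: "S \<subseteq> {1..r}" "i \<in> S"
    and orth: "orthogonal_outside r S a" and nonnull: "inner_prod (a i) (a i) \<noteq> 0"
  obtains b where "\<forall>k\<in>{1..r}. b k \<in> G1" and "outer_prod r b = outer_prod r a"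
    and "orthogonal_outside r (S - {i}) b"
proof -
  have i: "i \<in> {1..r}" using S by blast
  obtain y where y: "y \<in> G0" "inner_prod (a i) (a i) * y = 1"
    using scalar_inverse[OF inner_prod_scalar nonnull] a i by blast
  \<comment> \<open>The projection coefficient, with \<open>y\<close> the inverse of the square of
    \<open>a i\<close>.\<close>
  define c where "c k = - (inner_prod (a k) (a i) * y)" for k
  have c: "c k \<in> G0" if "k \<in> {1..r}" for k
    unfolding c_def using that a i y by (intro scalar_uminus scalar_mult inner_prod_scalar) auto
  define b where "b k = (if k \<in> S - {i} then a k + c k * a i else a k)" for k
  have b: "\<forall>k\<in>{1..r}. b k \<in> G1"
    using a i c by (auto simp: b_def intro: vector_lincomb)
  have bi: "b i = a i" and bk: "k \<notin> S \<Longrightarrow> b k = a k" for k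
    by (auto simp: b_def)
  have proj: "inner_prod (b k) (a i) = 0" if "k \<in> S - {i}" for k
  proof -
    have k: "k \<in> {1..r}" using that S by blast
    have "c k * inner_prod (a i) (a i) = - inner_prod (a k) (a i)"
      using y scalar_commute[OF y(1) inner_prod_scalar] a i by (simp add: c_def mult.assoc)
    then show ?thesis
      using that inner_prod_linear[OF c[OF k]] a i by (simp add: b_def)
  qed
  have outside: "inner_prod (b k) (a l) = 0" if "k \<in> {1..r}" "l \<in> {1..r} - S" "k \<noteq> l" for k l
  proof -
    have "inner_prod (a k) (a l) = 0" "inner_prod (a i) (a l) = 0"
      using that i S by (auto intro!: orthogonal_outsideD[OF orth])
    then show ?thesis
      using that a c by (auto simp: b_def intro: inner_prod_linear_eq_0)
  qed
  have "orthogonal_outside r (S - {i}) b"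
    unfolding orthogonal_outside_def
  proof (intro ballI impI)
    \<comment> \<open>Either \<open>k = i\<close>, where \<open>proj\<close> covers \<open>l\<close>
      in \<open>S\<close> and \<open>outside\<close> the other \<open>l\<close>, or \<open>k\<close>
      lies outside \<open>S\<close>, where \<open>outside\<close> applies to \<open>l\<close> and
      \<open>k\<close>.\<close>
    fix k l assume k: "k \<in> {1..r} - (S - {i})" and l: "l \<in> {1..r}" and "k \<noteq> l"
    then have "inner_prod (b l) (b k) = 0"
      using proj[of l] outside[of l k] outside[of i l] bi bk inner_prod_commute[of "b l" "b k"] i
      by (cases "k = i"; cases "l \<in> S") auto
    then show "inner_prod (b k) (b l) = 0"
      by (simp add: inner_prod_commute)
  qed
  moreover have "outer_prod r b = outer_prod r a"
    unfolding b_def using S i a c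
    by (intro outer_prod_transvections) (auto intro: finite_subset)
  ultimately show ?thesis
    using that b by blast
qed

text \<open>If \<open>a i\<close> and \<open>a j\<close> are both null, the square of their sum is
  twice their inner product and thus nonzero. Otherwise one of them is already not null and
  \<open>a\<close> itself serves.\<close>

lemma nonnull_transvection:
  assumes a: "\<forall>k\<in>{1..r}. a k \<in> G1" and S: "S \<subseteq> {1..r}" "i \<in> S" "j \<in> S" "i \<noteq> j"
    and orth: "orthogonal_outside r S a" and ij: "inner_prod (a i) (a j) \<noteq> 0"
  obtains b k where "\<forall>k\<in>{1..r}. b k \<in> G1" and "outer_prod r b = outer_prod r a"
    and "orthogonal_outside r S b" and "k \<in> S" and "inner_prod (b k) (b k) \<noteq> 0"
proof (cases "inner_prod (a i) (a i) = 0 \<and> inner_prod (a j) (a j) = 0")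
  case True
  \<comment> \<open>The coefficient \<open>1\<close> gives the sum the shape of a
    transvection.\<close>
  define b where "b = a(i := a i + 1 * a j)"
  have m: "i \<in> {1..r}" "j \<in> {1..r}" using S by auto
  have b: "\<forall>k\<in>{1..r}. b k \<in> G1"
    unfolding b_def using a m vector_lincomb[OF _ scalar_one] by simp
  have "inner_prod (b i) (b i) = inner_prod (a i) (a j) + inner_prod (a i) (a j)"
    using True by (simp add: b_def inner_prod_def algebra_simps)
  then have "inner_prod (b i) (b i) \<noteq> 0"
    using ij double_eq_0 by simp
  moreover have "orthogonal_outside r S b"
    unfolding orthogonal_outside_def
  proof (intro ballI impI)
    fix k l assume *: "k \<in> {1..r} - S" "l \<in> {1..r}" "k \<noteq> l"
    then have "inner_prod (a l) (a k) = 0" "inner_prod (a i) (a k) = 0" "inner_prod (a j) (a k) = 0"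
      using S m by (auto intro!: orthogonal_outsideD[OF orth])
    then have "inner_prod (b l) (a k) = 0"
      using * a inner_prod_linear_eq_0[OF scalar_one] by (simp add: b_def)
    moreover have "b k = a k"
      using * S by (auto simp: b_def)
    ultimately show "inner_prod (b k) (b l) = 0"
      by (simp add: inner_prod_commute)
  qed
  moreover have "outer_prod r b = outer_prod r a"
    unfolding b_def using m S a by (intro outer_prod_transvection scalar_one)
  ultimately show ?thesis
    using that b S by blast
qed (use that assms in blast)

text \<open>Each round produces a vector that is not null and splits it off, so that
  \<open>S\<close> loses an index. The family varies along the induction.\<close>

lemma orthogonalization:
  assumes "finite S" and "S \<subseteq> {1..r}" and "\<forall>k\<in>{1..r}. a k \<in> G1" and "orthogonal_outside r S a"
  shows "\<exists>b. (\<forall>k\<in>{1..r}. b k \<in> G1) \<and> outer_prod r b = outer_prod r a \<and> orthogonal_outside r {} b"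
  using assms
proof (induction S arbitrary: a rule: finite_psubset_induct)
  case (psubset S)
  show ?case
  proof (cases "\<forall>i\<in>S. \<forall>j\<in>S. i \<noteq> j \<longrightarrow> inner_prod (a i) (a j) = 0")
    \<comment> \<open>The process stops here: the remaining vectors may be null, but they are
      orthogonal to each other and to those split off.\<close>
    case True
    have "inner_prod (a i) (a j) = 0" if "i \<in> {1..r}" "j \<in> {1..r}" "i \<noteq> j" for i j
      using that True orthogonal_outsideD[OF psubset.prems(3), of i j]
        orthogonal_outsideD[OF psubset.prems(3), of j i] inner_prod_commute[of "a i"]
      by (cases "i \<in> S"; cases "j \<in> S") simp_all
    then show ?thesis
      using psubset.prems by (auto simp: orthogonal_outside_def)
  next
    case False
    then obtain i j where ij: "i \<in> S" "j \<in> S" "i \<noteq> j" "inner_prod (a i) (a j) \<noteq> 0"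
      by blast
    obtain b k where b: "\<forall>k\<in>{1..r}. b k \<in> G1" "outer_prod r b = outer_prod r a"
      "orthogonal_outside r S b" and k: "k \<in> S" "inner_prod (b k) (b k) \<noteq> 0"
      by (rule nonnull_transvection[OF psubset.prems(2,1) ij(1-3) psubset.prems(3) ij(4)])
    obtain d where "\<forall>k\<in>{1..r}. d k \<in> G1" "outer_prod r d = outer_prod r b"
      "orthogonal_outside r (S - {k}) d"
      using b(1) psubset.prems(1) k(1) b(3) k(2) by (rule split_off_nonnull)
    then show ?thesis
      using psubset.IH[of "S - {k}" d] psubset.prems(1) k(1) b(2) by auto
  qed
qed

section \<open>Blades as products of anticommuting vectors\<close>

lemma anticommuting_iff_orthogonal:
  "anticommuting r v \<longleftrightarrow> orthogonal_outside r {} v"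
  by (simp add: anticommuting_def orthogonal_outside_def inner_prod_eq_0)

text \<open>Treats \<open>r = 1\<close> uniformly with larger \<open>r\<close>, as anticommutation
  of a single vector is vacuous.\<close>

lemma blades_eq:
  assumes "r \<ge> 1"
  shows "blades G0 G1 r = {ordered_prod r v | v. (\<forall>i\<in>{1..r}. v i \<in> G1) \<and> anticommuting r v}"
proof (cases "r = 1")
  case True
  have "\<exists>v :: nat \<Rightarrow> 'a. x = v (Suc 0) \<and> v (Suc 0) \<in> G1" if "x \<in> G1" for x
    using that by (intro exI[of _ "\<lambda>_. x"]) simp
  then have "{v (Suc 0) | v. v (Suc 0) \<in> G1} = G1"
    by blast
  then show ?thesis
    using True by (simp add: blades_def anticommuting_def)
next
  case False
  then show ?thesis
    using assms by (simp add: blades_def anticommuting_def inner_prod_eq_0)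
qed

end

theorem theorem1:
  fixes G0 G1 :: "'a::ring_1 set" and r :: nat
  assumes "geometric_algebra G0 G1" and "r \<ge> 1"
  shows "(\<forall>a. (\<forall>i\<in>{1..r}. a i \<in> G1) \<longrightarrow> outer_prod r a \<in> blades G0 G1 r) \<and>
         (\<forall>b\<in>blades G0 G1 r. \<exists>a. (\<forall>i\<in>{1..r}. a i \<in> G1) \<and> b = outer_prod r a)"
proof -
  interpret geometric_algebra G0 G1 by fact
  have "outer_prod r a \<in> blades G0 G1 r" if a: "\<forall>i\<in>{1..r}. a i \<in> G1" for a
  proof -
    \<comment> \<open>No index lies outside \<open>{1..r}\<close>, so orthogonalization can start
      from any family.\<close>
    have "orthogonal_outside r {1..r} a"
      by (simp add: orthogonal_outside_def)
    then obtain b where "\<forall>k\<in>{1..r}. b k \<in> G1" "outer_prod r b = outer_prod r a" "anticommuting r b"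
      using orthogonalization[OF _ subset_refl a] unfolding anticommuting_iff_orthogonal by blast
    then show ?thesis
      using outer_prod_orthogonal[of r b] unfolding blades_eq[OF assms(2)] by force
  qed
  \<comment> \<open>The orthogonal factors of the blade themselves serve as the vectors of the outer
    product.\<close>
  moreover have "\<exists>a. (\<forall>i\<in>{1..r}. a i \<in> G1) \<and> b = outer_prod r a" if "b \<in> blades G0 G1 r" for b
    using that outer_prod_orthogonal unfolding blades_eq[OF assms(2)] by force
  ultimately show ?thesis
    by blast
qed

end
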